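(* Let $\theta>0$, $n\in\{1,2,\dots\}$, $0<\lambda<n$, $p_n=\lambda/n$. Let $W_{G,n}\sim PG(\theta,p_n)$, $Z_n=W_{G,n}/n$ and $W\sim PE(\theta,\lambda)$. Then for any bounded function $h:(0,\infty)\to\mathbb R$ with bounded first derivative, with $\tilde h(x)=h(x)-\mathbb E h(W)$, $$|\mathbb E h(Z_n)-\mathbb E h(W)|\le\frac{e^{\frac\lambda n}}{n}\left(1+\frac{e^{\frac{\theta\lambda}{ne}}}{n}B_1(\theta,\lambda)\right)\|h'\|+\frac1n\left(\left(1-\frac\lambda n\right)^{-6}e^{\theta e^{\frac\lambda n}+\frac{\theta\lambda}{n}+2\frac{\theta\lambda}{ne}+\frac\lambda n}B_2(\theta,\lambda)+\frac1{2n}e^{\frac\lambda n+\frac{\theta\lambda}{ne}}B_3(\theta,\lambda)\right)\|\tilde h\|,$$ where $$B_1(\theta,\lambda)=\lambda\max(1,\theta)+\frac{e^{\lambda\theta+\frac\theta e}}{2\theta\lambda}+\frac{\theta\lambda}{2e}\,\frac{1+e-e^{-\theta}}{1-e^{-\theta}},$$ $$B_2(\theta,\lambda)=11\lambda+9\lambda\theta+6\lambda\max(1,\theta)+\frac{3e^{\lambda\theta+\frac\theta e}}{\theta\lambda}+3\theta\lambda\frac{1+e-e^{-\theta}}{(1-e^{-\theta})e}+4\lambda e^{-\theta}\left(1+2\max(1,\theta)+\frac{(3e+1)\theta}{e}+\frac{(5e+3)\theta^2}{3e}+\frac{\theta(2\theta+1)}{1-e^{-\theta}}\right),$$ $$B_3(\theta,\lambda)=(9\lambda\theta+11\lambda)\left(2\lambda\max(1,\theta)+\frac{e^{\lambda\theta+\frac\theta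 e}}{\theta\lambda}+\theta\lambda\frac{1+e-e^{-\theta}}{(1-e^{-\theta})e}\right).$$
   Context: $PE(\theta,\lambda)$ (Poisson-exponential distribution) has pdf $\frac{\theta\lambda e^{-\lambda w-\theta e^{-\lambda w}}}{1-e^{-\theta}}$, $w>0$. $PG(\theta,p)$ (Poisson-geometric distribution) is the law of $\max\{T_1,\dots,T_M\}$ with $T_1,T_2,\dots$ i.i.d. Geometric$(p)$ on $\{1,2,\dots\}$ ($\mathbb P(T=k)=(1-p)^{k-1}p$) and $M$ an independent zero-truncated Poisson$(\theta)$ variable (Poisson$(\theta)$ conditioned to be $\ge1$); its pmf is $\frac{e^{-(1-p)^w\theta}-e^{-(1-p)^{w-1}\theta}}{1-e^{-\theta}}$, $w=1,2,\dots$. $\|\cdot\|$ is the supremum norm; $e$ is Euler's number. *)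

theory Defs
  imports "HOL-Probability.Probability"
begin

text \<open>Density of the Poisson-exponential distribution with respect to Lebesgue measure
  on the open half-line; it is only meaningful for positive \<open>w\<close>.\<close>

definition PE_density :: "real \<Rightarrow> real \<Rightarrow> real \<Rightarrow> real" where
  "PE_density \<theta> l w = \<theta> * l * exp (- l * w - \<theta> * exp (- l * w)) / (1 - exp (- \<theta>))"

text \<open>The base measure lives on the open half-line, so that a random variable with this law
  takes values in the domain of the test functions.\<close>

definition PE_distributed :: "'a measure \<Rightarrow> ('a \<Rightarrow> real) \<Rightarrow> real \<Rightarrow> real \<Rightarrow> bool" where
  "PE_distributed M W \<theta> l \<longleftrightarrow>
     distributed M (restrict_space lborel {0<..}) W (\<lambda>w. ennreal (PE_density \<theta> l w))"

definition zero_truncated_poisson_pmf :: "real \<Rightarrow> nat pmf" where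
  "zero_truncated_poisson_pmf \<theta> = cond_pmf (poisson_pmf \<theta>) {1..}"

text \<open>The library's \<^const>\<open>geometric_pmf\<close> counts failures and starts at \<open>0\<close>; hence the
  shift by \<^const>\<open>Suc\<close>.\<close>

definition PG_pmf :: "real \<Rightarrow> real \<Rightarrow> nat pmf" where
  "PG_pmf \<theta> p =
     bind_pmf (zero_truncated_poisson_pmf \<theta>)
       (\<lambda>m. map_pmf (\<lambda>ts. Max (set ts)) (replicate_pmf m (map_pmf Suc (geometric_pmf p))))"

definition PG_distributed :: "'a measure \<Rightarrow> ('a \<Rightarrow> nat) \<Rightarrow> real \<Rightarrow> real \<Rightarrow> bool" where
  "PG_distributed M X \<theta> p \<longleftrightarrow>
     X \<in> measurable M (count_space UNIV) \<and>
     distr M (count_space UNIV) X = measure_pmf (PG_pmf \<theta> p)"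

text \<open>Supremum norm on the open half-line; it is only used for functions bounded there.\<close>

definition sup_norm :: "(real \<Rightarrow> real) \<Rightarrow> real" where
  "sup_norm f = (SUP x\<in>{0<..}. \<bar>f x\<bar>)"

definition B1 :: "real \<Rightarrow> real \<Rightarrow> real" where
  "B1 \<theta> l =
     l * max 1 \<theta> + exp (l * \<theta> + \<theta> / exp 1) / (2 * \<theta> * l)
     + \<theta> * l / (2 * exp 1) * ((1 + exp 1 - exp (- \<theta>)) / (1 - exp (- \<theta>)))"

definition B2 :: "real \<Rightarrow> real \<Rightarrow> real" where
  "B2 \<theta> l =
     11 * l + 9 * l * \<theta> + 6 * l * max 1 \<theta> + 3 * exp (l * \<theta> + \<theta> / exp 1) / (\<theta> * l)
     + 3 * \<theta> * l * ((1 + exp 1 - exp (- \<theta>)) / ((1 - exp (- \<theta>)) * exp 1))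
     + 4 * l * exp (- \<theta>) *
         (1 + 2 * max 1 \<theta> + (3 * exp 1 + 1) * \<theta> / exp 1
          + (5 * exp 1 + 3) * \<theta>\<^sup>2 / (3 * exp 1)
          + \<theta> * (2 * \<theta> + 1) / (1 - exp (- \<theta>)))"

definition B3 :: "real \<Rightarrow> real \<Rightarrow> real" where
  "B3 \<theta> l =
     (9 * l * \<theta> + 11 * l) *
       (2 * l * max 1 \<theta> + exp (l * \<theta> + \<theta> / exp 1) / (\<theta> * l)
        + \<theta> * l * ((1 + exp 1 - exp (- \<theta>)) / ((1 - exp (- \<theta>)) * exp 1)))"

end

(* Let p = lambda / n and mu = - n ln (1 - p). If T is exponential of rate mu, then the ceiling of
   n T is geometric with parameter p; since rounding up commutes with maxima, the ceiling of n W' is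
   PG(theta, p) when W' is PE(theta, mu), and undoing the rounding costs at most |h'| / n. It
   remains to change the rate of the Poisson-exponential law from mu to lambda. As mu - lambda is
   of order 1 / n, integrating a bound on the derivative of the density in the rate controls the
   L1 distance of the densities by 2 p (1 + theta) / (1 - p)^2, far below the B2 term. *)

theory Submission
  imports Defs "HOL-Real_Asymp.Real_Asymp"
begin

section \<open>Distribution function of the Poisson-geometric law\<close>

text \<open>Peeling off the first coordinate turns independence into a product. For
  \<open>A = {..k}\<close> this is the distribution function of the maximum of \<open>m\<close>
  draws; inclusion, unlike \<open>Max\<close>, also makes sense for the empty list.\<close>

lemma emeasure_replicate_pmf_subset:
  "emeasure (replicate_pmf m p) {ts. set ts \<subseteq> A} = emeasure (measure_pmf p) A ^ m"
proof (induction m)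
  case 0
  then show ?case by (simp add: emeasure_return_pmf)
next
  case (Suc m)
  have "emeasure (return_pmf (x # ts)) {us. set us \<subseteq> A}
      = indicator A x * indicator {us. set us \<subseteq> A} ts" for x ts
    by (auto split: split_indicator)
  then have "emeasure (replicate_pmf (Suc m) p) {us. set us \<subseteq> A}
      = (\<integral>\<^sup>+x. indicator A x * emeasure (replicate_pmf m p) {us. set us \<subseteq> A} \<partial>measure_pmf p)"
    by (simp add: nn_integral_cmult)
  then show ?case
    by (simp add: Suc.IH nn_integral_multc)
qed

lemma prob_geometric_pmf_lessThan:
  assumes "0 < p" "p \<le> 1"
  shows "measure_pmf.prob (geometric_pmf p) {..<k} = 1 - (1 - p) ^ k"
proof -
  have "measure_pmf.prob (geometric_pmf p) {..<k} = p * (\<Sum>i<k. (1 - p) ^ i)"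
    using assms by (simp add: measure_measure_pmf_finite sum_distrib_left mult.commute)
  also have "\<dots> = 1 - (1 - p) ^ k"
    using one_diff_power_eq[of "1 - p" k] by simp
  finally show ?thesis .
qed

text \<open>The probability generating function of the truncated law: the exponential series without
  its constant term, renormalised. The form in \<open>1 - x\<close> suits the later argument
  \<open>x = 1 - (1 - p) ^ k\<close>.\<close>

lemma nn_integral_power_zero_truncated_poisson_pmf:
  fixes x :: real
  assumes "\<theta> > 0" "0 \<le> x"
  shows "(\<integral>\<^sup>+m. ennreal x ^ m \<partial>zero_truncated_poisson_pmf \<theta>)
       = ennreal ((exp (- \<theta> * (1 - x)) - exp (- \<theta>)) / (1 - exp (- \<theta>)))"
proof -
  have ne: "set_pmf (poisson_pmf \<theta>) \<inter> {1..} \<noteq> {}"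
    using assms by (auto simp: set_pmf_poisson)
  have "- {1..} = {0::nat}" by auto
  then have "measure_pmf.prob (poisson_pmf \<theta>) {1..} = 1 - pmf (poisson_pmf \<theta>) 0"
    using measure_pmf.prob_compl[of "{1..}" "poisson_pmf \<theta>"]
    by (simp add: Compl_eq_Diff_UNIV[symmetric] measure_pmf_single)
  then have pos: "measure_pmf.prob (poisson_pmf \<theta>) {1..} = 1 - exp (- \<theta>)"
    using assms by simp
  define c where "c = exp (- \<theta>) / (1 - exp (- \<theta>))"
  have c: "0 \<le> c" using assms by (simp add: c_def)
  have pmf: "pmf (zero_truncated_poisson_pmf \<theta>) m = (if m = 0 then 0 else c * (\<theta> ^ m / fact m))" for m
    unfolding zero_truncated_poisson_pmf_def pmf_cond[OF ne] pos c_def using assms by (simp add: mult_ac)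
  have "(\<lambda>m. (\<theta> * x) ^ m / fact m) sums exp (\<theta> * x)"
    using exp_converges[of "\<theta> * x"] by (simp add: divide_inverse mult.commute)
  \<comment> \<open>Truncation removes the term \<open>m = 0\<close> of the exponential series,
    which equals 1.\<close>
  then have "(\<lambda>m. c * ((\<theta> * x) ^ m / fact m - (if m = 0 then 1 else 0)))
      sums (c * (exp (\<theta> * x) - 1))"
    by (intro sums_mult sums_diff) (use sums_single[of 0 "\<lambda>_. 1::real"] in simp_all)
  also have "(\<lambda>m. c * ((\<theta> * x) ^ m / fact m - (if m = 0 then 1 else 0)))
      = (\<lambda>m. pmf (zero_truncated_poisson_pmf \<theta>) m * x ^ m)"
    by (auto simp: pmf power_mult_distrib)
  also have "c * (exp (\<theta> * x) - 1) = (exp (- \<theta> * (1 - x)) - exp (- \<theta>)) / (1 - exp (- \<theta>))"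
    by (simp add: c_def right_diff_distrib diff_divide_distrib flip: exp_add)
  finally have *: "(\<lambda>m. pmf (zero_truncated_poisson_pmf \<theta>) m * x ^ m)
      sums ((exp (- \<theta> * (1 - x)) - exp (- \<theta>)) / (1 - exp (- \<theta>)))" .
  have "(\<integral>\<^sup>+m. ennreal x ^ m \<partial>zero_truncated_poisson_pmf \<theta>)
      = (\<Sum>m. ennreal (pmf (zero_truncated_poisson_pmf \<theta>) m * x ^ m))"
    using assms by (simp add: nn_integral_measure_pmf nn_integral_count_space_nat ennreal_mult ennreal_power)
  also have "\<dots> = ennreal ((exp (- \<theta> * (1 - x)) - exp (- \<theta>)) / (1 - exp (- \<theta>)))"
    using assms by (intro suminf_ennreal_eq *) simp
  finally show ?thesis .
qed

text \<open>Given \<open>m\<close> draws, their maximum is at most \<open>k\<close> with probability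
  \<open>(1 - (1 - p) ^ k) ^ m\<close>; averaging over \<open>m\<close> evaluates the generating
  function.\<close>

lemma emeasure_PG_pmf_atMost:
  assumes "\<theta> > 0" "0 < p" "p \<le> 1"
  shows "emeasure (PG_pmf \<theta> p) {..k}
       = ennreal ((exp (- \<theta> * (1 - p) ^ k) - exp (- \<theta>)) / (1 - exp (- \<theta>)))"
proof -
  let ?g = "map_pmf Suc (geometric_pmf p)"
  have F: "emeasure (measure_pmf ?g) {..k} = ennreal (1 - (1 - p) ^ k)"
  proof -
    \<comment> \<open>The shift from counting failures to counting trials turns the bound
      \<open>\<le> k\<close> into a strict one.\<close>
    have "Suc -` {..k} = {..<k}" by auto
    then show ?thesis
      using assms by (simp add: measure_pmf.emeasure_eq_measure prob_geometric_pmf_lessThan)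
  qed
  have "emeasure (PG_pmf \<theta> p) {..k}
      = (\<integral>\<^sup>+m. emeasure (replicate_pmf m ?g) {ts. Max (set ts) \<le> k} \<partial>zero_truncated_poisson_pmf \<theta>)"
    by (simp add: PG_pmf_def vimage_def)
  also have "\<dots> = (\<integral>\<^sup>+m. ennreal (1 - (1 - p) ^ k) ^ m \<partial>zero_truncated_poisson_pmf \<theta>)"
  proof (intro nn_integral_cong_AE AE_pmfI)
    fix m assume "m \<in> set_pmf (zero_truncated_poisson_pmf \<theta>)"
    then have "m \<ge> 1"
      using assms by (auto simp: zero_truncated_poisson_pmf_def)
    \<comment> \<open>Truncation guarantees a nonempty list; \<open>Max\<close> of the empty set
      would be unspecified.\<close>
    then have "Max (set ts) \<le> k \<longleftrightarrow> set ts \<subseteq> {..k}" if "length ts = m" for ts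
      using that Max_le_iff[of "set ts" k] by fastforce
    then have "emeasure (replicate_pmf m ?g) {ts. Max (set ts) \<le> k}
        = emeasure (replicate_pmf m ?g) {ts. set ts \<subseteq> {..k}}"
      by (intro emeasure_eq_AE AE_pmfI) (auto simp: set_replicate_pmf)
    then show "emeasure (replicate_pmf m ?g) {ts. Max (set ts) \<le> k} = ennreal (1 - (1 - p) ^ k) ^ m"
      by (simp only: emeasure_replicate_pmf_subset F)
  qed
  also have "\<dots> = ennreal ((exp (- \<theta> * (1 - p) ^ k) - exp (- \<theta>)) / (1 - exp (- \<theta>)))"
    using assms by (subst nn_integral_power_zero_truncated_poisson_pmf) (auto simp: power_le_one)
  finally show ?thesis .
qed

text \<open>Singletons are differences of consecutive initial segments, and finiteness legitimises
  the subtraction. This lets laws on the naturals be compared through distribution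
  functions.\<close>

lemma measure_nat_eqI_atMost:
  fixes M N :: "nat measure"
  assumes sets: "sets M = UNIV" "sets N = UNIV"
    and fin: "\<And>k. emeasure M {..k} \<noteq> \<infinity>"
    and eq: "\<And>k. emeasure M {..k} = emeasure N {..k}"
  shows "M = N"
proof (rule measure_eqI_countable[where A = UNIV])
  fix k :: nat
  have single: "emeasure L {k} = emeasure L {..k} - (if k = 0 then 0 else emeasure L {..k - 1})"
    if "sets L = UNIV" "\<And>k. emeasure L {..k} \<noteq> \<infinity>" for L :: "nat measure"
  proof (cases k)
    case (Suc j)
    then have "{k} = {..k} - {..j}" by auto
    with Suc show ?thesis
      using that emeasure_Diff[of L "{..j}" "{..k}"] by auto
  qed simp
  show "emeasure M {k} = emeasure N {k}"
    using single[of M] single[of N] sets fin eq by simp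
qed (use sets in auto)

section \<open>The Poisson-exponential law and integrals over the open half-line\<close>

text \<open>The antiderivative exceeds the true distribution function by the constant
  \<open>exp (- \<theta>) / (1 - exp (- \<theta>))\<close>, which cancels in differences.\<close>

lemma has_real_derivative_PE_cdf:
  assumes "\<theta> > 0"
  shows "((\<lambda>w. exp (- \<theta> * exp (- l * w)) / (1 - exp (- \<theta>))) has_real_derivative PE_density \<theta> l w) (at w)"
proof -
  have "((\<lambda>w. exp (- \<theta> * exp (- l * w)) / (1 - exp (- \<theta>))) has_real_derivative
      exp (- \<theta> * exp (- l * w)) * (- \<theta> * (exp (- l * w) * - l)) / (1 - exp (- \<theta>))) (at w)"
    using assms by (auto intro!: derivative_eq_intros)
  also have "exp (- \<theta> * exp (- l * w)) * (- \<theta> * (exp (- l * w) * - l)) / (1 - exp (- \<theta>))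
      = PE_density \<theta> l w"
    unfolding PE_density_def by (simp add: exp_add[of "- l * w" "- \<theta> * exp (- l * w)", simplified] mult_ac)
  finally show ?thesis .
qed

lemma PE_density_nonneg: "\<theta> > 0 \<Longrightarrow> l > 0 \<Longrightarrow> 0 \<le> PE_density \<theta> l w"
  by (simp add: PE_density_def)

lemma borel_measurable_PE_density[measurable]: "PE_density \<theta> l \<in> borel_measurable borel"
  unfolding PE_density_def by measurable

abbreviation pos_lborel :: "real measure" where
  "pos_lborel \<equiv> restrict_space lborel {0<..}"

lemma borel_measurable_pos_lborel: "f \<in> borel_measurable borel \<Longrightarrow> f \<in> borel_measurable pos_lborel"
  by (intro measurable_restrict_space1) simp

text \<open>The origin is a null set, so it can be added to the domain and the fundamental theorem
  on a closed half-line applies.\<close>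

lemma nn_integral_pos_lborel_FTC:
  fixes f F :: "real \<Rightarrow> real"
  assumes "f \<in> borel_measurable borel"
    and "\<And>x. 0 \<le> x \<Longrightarrow> (F has_real_derivative f x) (at x)"
    and "\<And>x. 0 \<le> x \<Longrightarrow> 0 \<le> f x"
    and "(F \<longlongrightarrow> T) at_top"
  shows "(\<integral>\<^sup>+x. ennreal (f x) \<partial>pos_lborel) = ennreal (T - F 0)"
proof -
  have "(\<integral>\<^sup>+x. ennreal (f x) \<partial>pos_lborel) = (\<integral>\<^sup>+x. ennreal (f x) * indicator {0..} x \<partial>lborel)"
    by (subst nn_integral_restrict_space, simp, intro nn_integral_cong_AE eventually_mono[OF AE_lborel_singleton[of 0]])
       (auto split: split_indicator)
  then show ?thesis
    using nn_integral_FTC_atLeast[OF assms] by simp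
qed

lemma nn_integral_PE_density:
  assumes "\<theta> > 0" "l > 0"
  shows "(\<integral>\<^sup>+w. ennreal (PE_density \<theta> l w) \<partial>pos_lborel) = 1"
proof -
  let ?F = "\<lambda>w. exp (- \<theta> * exp (- l * w)) / (1 - exp (- \<theta>))"
  have "LIM w at_top. l * w :> at_top"
    using assms by (intro filterlim_tendsto_pos_mult_at_top[OF tendsto_const] filterlim_ident)
  then have "((\<lambda>w. exp (- l * w)) \<longlongrightarrow> 0) at_top"
    by (intro filterlim_compose[OF exp_at_bot]) (simp add: filterlim_uminus_at_bot)
  then have "(?F \<longlongrightarrow> exp (- \<theta> * 0) / (1 - exp (- \<theta>))) at_top"
    using assms by (intro tendsto_intros) auto
  then have "(\<integral>\<^sup>+w. ennreal (PE_density \<theta> l w) \<partial>pos_lborel)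
      = ennreal (exp (- \<theta> * 0) / (1 - exp (- \<theta>)) - ?F 0)"
    by (intro nn_integral_pos_lborel_FTC has_real_derivative_PE_cdf)
       (use assms in \<open>auto simp: PE_density_nonneg\<close>)
  also have "exp (- \<theta> * 0) / (1 - exp (- \<theta>)) - ?F 0 = 1"
    using assms by (simp flip: diff_divide_distrib)
  finally show ?thesis by simp
qed

lemma has_bochner_integral_PE_density:
  assumes "\<theta> > 0" "l > 0"
  shows "has_bochner_integral pos_lborel (PE_density \<theta> l) 1"
  using assms by (intro has_bochner_integral_nn_integral)
    (auto simp: nn_integral_PE_density PE_density_nonneg intro: borel_measurable_pos_lborel)

lemma integrable_PE_density_mult:
  assumes "\<theta> > 0" "l > 0" "H \<in> borel_measurable pos_lborel" "\<And>x. x > 0 \<Longrightarrow> \<bar>H x\<bar> \<le> S"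
  shows "integrable pos_lborel (\<lambda>w. PE_density \<theta> l w * H w)"
proof (rule Bochner_Integration.integrable_bound)
  show "integrable pos_lborel (\<lambda>w. PE_density \<theta> l w * S)"
    using has_bochner_integral_PE_density[OF assms(1,2)] by (simp add: has_bochner_integral_iff)
  show "AE w in pos_lborel. norm (PE_density \<theta> l w * H w) \<le> norm (PE_density \<theta> l w * S)"
    using assms(4) by (intro AE_I2) (fastforce simp: abs_mult intro!: mult_left_mono)
  show "(\<lambda>w. PE_density \<theta> l w * H w) \<in> borel_measurable pos_lborel"
    using assms(3) by (intro borel_measurable_times borel_measurable_pos_lborel[of "PE_density \<theta> l"]) auto
qed

section \<open>Rounding up the Poisson-exponential law\<close>

text \<open>For \<open>w > 0\<close> the rounded value is at most \<open>k\<close> exactly when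
  \<open>w \<le> k / n\<close>. The condition tying \<open>\<mu>\<close> to \<open>p\<close> gives
  \<open>exp (- \<mu> * (k / n)) = (1 - p) ^ k\<close>, so the two distribution functions
  agree.\<close>

lemma distr_ceiling_PE_eq_PG:
  assumes "\<theta> > 0" "\<mu> > 0" "0 < p" "p < 1" "n > 0" and \<mu>: "exp (- \<mu> / real n) = 1 - p"
  shows "distr (density pos_lborel (PE_density \<theta> \<mu>)) (count_space UNIV) (\<lambda>w. nat \<lceil>real n * w\<rceil>)
       = measure_pmf (PG_pmf \<theta> p)"
    (is "?D = _")
proof (rule sym, rule measure_nat_eqI_atMost)
  fix k
  let ?F = "\<lambda>w. exp (- \<theta> * exp (- \<mu> * w)) / (1 - exp (- \<theta>))"
  have [measurable]: "(\<lambda>w. nat \<lceil>real n * w\<rceil>) \<in> measurable pos_lborel (count_space UNIV)"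
    by (intro measurable_restrict_space1) measurable
  have [measurable]: "PE_density \<theta> \<mu> \<in> borel_measurable pos_lborel"
    by (intro borel_measurable_pos_lborel) simp
  have exp: "exp (- \<mu> * (real k / real n)) = (1 - p) ^ k"
    using exp_of_nat_mult[of k "- \<mu> / real n"] \<mu> by (simp add: mult.commute)
  have sets: "{w \<in> {0<..}. nat \<lceil>real n * w\<rceil> \<le> k} \<in> sets pos_lborel"
    by (subst sets_restrict_space_iff) auto
  have "emeasure ?D {..k}
      = (\<integral>\<^sup>+w. ennreal (PE_density \<theta> \<mu> w) * indicator {w \<in> {0<..}. nat \<lceil>real n * w\<rceil> \<le> k} w \<partial>pos_lborel)"
    by (subst emeasure_distr, simp, simp, subst emeasure_density[OF _ sets, symmetric])
       (auto simp: space_restrict_space intro!: arg_cong[where f = "emeasure _"])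
  also have "\<dots> = (\<integral>\<^sup>+w. ennreal (PE_density \<theta> \<mu> w) * indicator {0..real k / real n} w \<partial>lborel)"
    using assms
    by (subst nn_integral_restrict_space, simp, intro nn_integral_cong_AE eventually_mono[OF AE_lborel_singleton[of 0]])
       (auto split: split_indicator simp: ceiling_le_iff nat_le_iff field_simps)
  also have "\<dots> = ennreal (?F (real k / real n) - ?F 0)"
    using assms by (intro nn_integral_FTC_Icc has_real_derivative_PE_cdf[THEN has_field_derivative_at_within])
      (auto simp: PE_density_nonneg)
  also have "?F (real k / real n) - ?F 0 = (exp (- \<theta> * (1 - p) ^ k) - exp (- \<theta>)) / (1 - exp (- \<theta>))"
    unfolding exp by (simp flip: diff_divide_distrib)
  finally show "emeasure (PG_pmf \<theta> p) {..k} = emeasure ?D {..k}"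
    using assms by (subst emeasure_PG_pmf_atMost) auto
qed (auto simp: measure_pmf.emeasure_finite)

section \<open>Changing the rate\<close>

text \<open>Mean value theorem in the rate, at fixed \<open>w\<close>. The inner exponential absorbs
  the factor \<open>\<theta> * exp (- s * w)\<close> produced by differentiation, which leaves a
  majorant integrable in \<open>w\<close>.\<close>

lemma PE_density_rate_diff_le:
  assumes "\<theta> > 0" "0 < l" "l < \<mu>" "w \<ge> 0"
  shows "\<bar>PE_density \<theta> \<mu> w - PE_density \<theta> l w\<bar>
       \<le> (\<mu> - l) * (\<theta> / (1 - exp (- \<theta>))) * ((1 + \<mu> * w) * exp (- l * w))"
proof -
  define c where "c = \<theta> / (1 - exp (- \<theta>))"
  have c: "c > 0" using assms by (simp add: c_def)
  \<comment> \<open>Derivative of the density in its rate \<open>s\<close>: the exponent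
    \<open>- s * w - \<theta> * exp (- s * w)\<close> contributes the factor
    \<open>w * (\<theta> * exp (- s * w) - 1)\<close>.\<close>
  define D where "D = (\<lambda>s. c * exp (- s * w - \<theta> * exp (- s * w)) * (1 + s * (w * (\<theta> * exp (- s * w) - 1))))"
  have "\<exists>z>l. z < \<mu> \<and> PE_density \<theta> \<mu> w - PE_density \<theta> l w = (\<mu> - l) * D z"
  proof (rule MVT2[OF \<open>l < \<mu>\<close>])
    fix s
    have "((\<lambda>s. c * (s * exp (- s * w - \<theta> * exp (- s * w)))) has_real_derivative D s) (at s)"
      unfolding D_def by (auto intro!: derivative_eq_intros simp: algebra_simps)
    then show "((\<lambda>s. PE_density \<theta> s w) has_real_derivative D s) (at s)"
      by (simp add: PE_density_def c_def mult.assoc)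
  qed
  then obtain z where z: "l < z" "z < \<mu>" and eq: "PE_density \<theta> \<mu> w - PE_density \<theta> l w = (\<mu> - l) * D z"
    by blast
  define u where "u = \<theta> * exp (- z * w)"
  have u: "u > 0" using assms by (simp add: u_def)
  have zw: "0 \<le> z * w" using assms z by simp
  have "\<bar>1 + z * (w * (u - 1))\<bar> \<le> 1 + z * w * (1 + u)"
    using mult_nonneg_nonneg[OF zw less_imp_le[OF u]] zw by (simp add: algebra_simps abs_le_iff)
  also have "\<dots> \<le> (1 + z * w) * (1 + u)"
    using u by (simp add: algebra_simps)
  \<comment> \<open>The bound \<open>1 + u \<le> exp u\<close> is chosen to cancel the factor
    \<open>exp (- u)\<close> in \<open>D z\<close>.\<close>
  also have "\<dots> \<le> (1 + z * w) * exp u"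
    using zw exp_ge_add_one_self[of u] by (intro mult_left_mono) auto
  finally have "exp (- u) * \<bar>1 + z * (w * (u - 1))\<bar> \<le> exp (- u) * ((1 + z * w) * exp u)"
    by (rule mult_left_mono) simp
  also have "\<dots> = 1 + z * w"
    by (simp add: exp_minus)
  also have "\<dots> \<le> 1 + \<mu> * w"
    using z assms by (simp add: mult_right_mono)
  \<comment> \<open>The unknown \<open>z\<close> is eliminated by taking the decay at the smaller
    rate \<open>l\<close> and the growth at the larger rate \<open>\<mu>\<close>.\<close>
  finally have "exp (- z * w) * (exp (- u) * \<bar>1 + z * (w * (u - 1))\<bar>) \<le> exp (- l * w) * (1 + \<mu> * w)"
    using z assms by (intro mult_mono) (auto simp: mult_right_mono)
  then have "c * (exp (- z * w) * (exp (- u) * \<bar>1 + z * (w * (u - 1))\<bar>)) \<le> c * (exp (- l * w) * (1 + \<mu> * w))"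
    using c by (intro mult_left_mono) auto
  moreover have "\<bar>D z\<bar> = c * (exp (- z * w) * (exp (- u) * \<bar>1 + z * (w * (u - 1))\<bar>))"
    using c by (simp add: D_def abs_mult exp_diff exp_minus divide_inverse u_def)
  ultimately have "\<bar>D z\<bar> \<le> c * ((1 + \<mu> * w) * exp (- l * w))"
    by (simp add: mult_ac)
  then have "(\<mu> - l) * \<bar>D z\<bar> \<le> (\<mu> - l) * (c * ((1 + \<mu> * w) * exp (- l * w)))"
    using assms by (intro mult_left_mono) auto
  then show ?thesis
    unfolding eq c_def using assms by (simp add: abs_mult mult.assoc)
qed

lemma has_bochner_integral_affine_times_exp:
  assumes "0 < l" "0 \<le> (\<mu> :: real)"
  shows "has_bochner_integral pos_lborel (\<lambda>w. (1 + \<mu> * w) * exp (- l * w)) (1 / l + \<mu> / l\<^sup>2)"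
proof (rule has_bochner_integral_nn_integral)
  \<comment> \<open>Antiderivative found by parts; it vanishes at infinity, so the integral is
    \<open>- ?F 0\<close>.\<close>
  let ?F = "\<lambda>w. - (1 / l + \<mu> / l\<^sup>2 + \<mu> / l * w) * exp (- l * w)"
  have "(?F \<longlongrightarrow> 0) at_top"
    using assms by real_asymp
  then have "(\<integral>\<^sup>+w. ennreal ((1 + \<mu> * w) * exp (- l * w)) \<partial>pos_lborel) = ennreal (0 - ?F 0)"
    using assms
    by (intro nn_integral_pos_lborel_FTC)
       (auto intro!: derivative_eq_intros simp: field_simps power2_eq_square)
  then show "(\<integral>\<^sup>+w. ennreal ((1 + \<mu> * w) * exp (- l * w)) \<partial>pos_lborel) = ennreal (1 / l + \<mu> / l\<^sup>2)"
    by (simp add: add.commute)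
qed (use assms in \<open>auto intro!: borel_measurable_pos_lborel AE_I2 simp: space_restrict_space\<close>)

text \<open>Integrates the pointwise estimate on the densities against a bounded function;
  \<open>H\<close> will be the centred test function.\<close>

lemma PE_expectation_rate_diff_le:
  assumes "\<theta> > 0" "0 < l" "l < \<mu>"
    and H: "H \<in> borel_measurable pos_lborel" "\<And>x. x > 0 \<Longrightarrow> \<bar>H x\<bar> \<le> S"
  shows "\<bar>(\<integral>w. PE_density \<theta> \<mu> w * H w \<partial>pos_lborel) - (\<integral>w. PE_density \<theta> l w * H w \<partial>pos_lborel)\<bar>
       \<le> (\<mu> - l) * (\<theta> / (1 - exp (- \<theta>))) * (1 / l + \<mu> / l\<^sup>2) * S"
proof -
  let ?c = "(\<mu> - l) * (\<theta> / (1 - exp (- \<theta>)))"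
  note int = has_bochner_integral_affine_times_exp[of l \<mu>]
  have "\<bar>(\<integral>w. PE_density \<theta> \<mu> w * H w \<partial>pos_lborel) - (\<integral>w. PE_density \<theta> l w * H w \<partial>pos_lborel)\<bar>
      = \<bar>\<integral>w. (PE_density \<theta> \<mu> w - PE_density \<theta> l w) * H w \<partial>pos_lborel\<bar>"
    using assms by (simp add: left_diff_distrib integrable_PE_density_mult[of _ _ _ S])
  also have "\<dots> \<le> (\<integral>w. ?c * ((1 + \<mu> * w) * exp (- l * w)) * S \<partial>pos_lborel)"
  proof (rule Bochner_Integration.integral_abs_bound[THEN order_trans], rule integral_mono)
    show "integrable pos_lborel (\<lambda>w. \<bar>(PE_density \<theta> \<mu> w - PE_density \<theta> l w) * H w\<bar>)"
      using assms by (simp add: left_diff_distrib integrable_PE_density_mult[of _ _ _ S])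
    show "integrable pos_lborel (\<lambda>w. ?c * ((1 + \<mu> * w) * exp (- l * w)) * S)"
      using int assms by (intro integrable_mult_left integrable_mult_right) (auto simp: has_bochner_integral_iff)
    fix w assume "w \<in> space pos_lborel"
    then have w: "w > 0" by (simp add: space_restrict_space)
    show "\<bar>(PE_density \<theta> \<mu> w - PE_density \<theta> l w) * H w\<bar> \<le> ?c * ((1 + \<mu> * w) * exp (- l * w)) * S"
      unfolding abs_mult using assms w H(2)[OF w] PE_density_rate_diff_le[of \<theta> l \<mu> w]
      by (intro mult_mono) auto
  qed
  also have "\<dots> = ?c * (1 / l + \<mu> / l\<^sup>2) * S"
    using int assms by (simp add: has_bochner_integral_iff)
  finally show ?thesis .
qed

section \<open>The cost of rounding up\<close>

text \<open>Rounding moves each point to the right by at most \<open>1 / n\<close>, hence changes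
  \<open>h\<close> by at most \<open>L / n\<close>; the density has total mass 1.\<close>

lemma PE_expectation_ceiling_diff_le:
  fixes h h' :: "real \<Rightarrow> real"
  assumes "\<theta> > 0" "\<mu> > 0" "n > (0::nat)"
    and h: "\<And>x. x > 0 \<Longrightarrow> (h has_real_derivative h' x) (at x)" "\<And>x. x > 0 \<Longrightarrow> \<bar>h' x\<bar> \<le> L"
    and int: "integrable pos_lborel (\<lambda>w. PE_density \<theta> \<mu> w * h (real (nat \<lceil>real n * w\<rceil>) / real n))"
      "integrable pos_lborel (\<lambda>w. PE_density \<theta> \<mu> w * h w)"
  shows "\<bar>(\<integral>w. PE_density \<theta> \<mu> w * h (real (nat \<lceil>real n * w\<rceil>) / real n) \<partial>pos_lborel)
            - (\<integral>w. PE_density \<theta> \<mu> w * h w \<partial>pos_lborel)\<bar> \<le> L / real n"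
proof -
  let ?r = "\<lambda>w. real (nat \<lceil>real n * w\<rceil>) / real n"
  have L: "0 \<le> L" using h(2)[of 1] by simp
  note PE = has_bochner_integral_PE_density[OF assms(1,2)]
  have "\<bar>(\<integral>w. PE_density \<theta> \<mu> w * h (?r w) \<partial>pos_lborel) - (\<integral>w. PE_density \<theta> \<mu> w * h w \<partial>pos_lborel)\<bar>
      = \<bar>\<integral>w. PE_density \<theta> \<mu> w * (h (?r w) - h w) \<partial>pos_lborel\<bar>"
    using int by (simp add: right_diff_distrib)
  also have "\<dots> \<le> (\<integral>w. PE_density \<theta> \<mu> w * (L / real n) \<partial>pos_lborel)"
  proof (rule Bochner_Integration.integral_abs_bound[THEN order_trans], rule integral_mono)
    show "integrable pos_lborel (\<lambda>w. \<bar>PE_density \<theta> \<mu> w * (h (?r w) - h w)\<bar>)"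
      using int by (simp add: right_diff_distrib)
    show "integrable pos_lborel (\<lambda>w. PE_density \<theta> \<mu> w * (L / real n))"
      using PE by (intro integrable_mult_left) (auto simp: has_bochner_integral_iff)
    fix w assume "w \<in> space pos_lborel"
    then have w: "w > 0" by (simp add: space_restrict_space)
    have ceil: "real (nat \<lceil>real n * w\<rceil>) = of_int \<lceil>real n * w\<rceil>"
      using w assms by simp
    have "real n * w \<le> of_int \<lceil>real n * w\<rceil>" "of_int \<lceil>real n * w\<rceil> \<le> real n * w + 1"
      by linarith+
    then have "w \<le> ?r w" "?r w \<le> (real n * w + 1) / real n"
      unfolding ceil using assms by (auto simp: pos_le_divide_eq mult.commute intro: divide_right_mono)
    moreover have "(real n * w + 1) / real n = w + 1 / real n"
      using assms by (simp add: field_simps)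
    ultimately have r: "w \<le> ?r w" "?r w - w \<le> 1 / real n"
      by auto
    \<comment> \<open>Since \<open>w \<le> ?r w\<close>, both points lie in the convex half-line on
      which \<open>h\<close> is differentiable.\<close>
    have "norm (h (?r w) - h w) \<le> L * norm (?r w - w)"
      by (rule field_differentiable_bound[of "{0<..}" h h'])
         (use h w r(1) in \<open>auto intro: has_field_derivative_at_within\<close>)
    also have "\<dots> \<le> L * (1 / real n)"
      using L r by (intro mult_left_mono) auto
    finally have "\<bar>h (?r w) - h w\<bar> \<le> L / real n" by simp
    then show "\<bar>PE_density \<theta> \<mu> w * (h (?r w) - h w)\<bar> \<le> PE_density \<theta> \<mu> w * (L / real n)"
      using PE_density_nonneg[OF assms(1,2)] by (simp only: abs_mult abs_of_nonneg mult_left_mono)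
  qed
  also have "\<dots> = L / real n"
    using PE by (simp add: has_bochner_integral_iff)
  finally show ?thesis .
qed

section \<open>The supremum norm and the constants of the bound\<close>

lemma le_sup_norm:
  assumes "bounded (f ` {0<..})" "x > 0"
  shows "\<bar>f x\<bar> \<le> sup_norm f"
proof -
  obtain b where "\<forall>y\<in>f ` {0<..}. norm y \<le> b"
    using assms(1) bounded_iff by blast
  then have "bdd_above ((\<lambda>x. \<bar>f x\<bar>) ` {0<..})"
    by (intro bdd_aboveI[of _ b]) auto
  then show ?thesis
    unfolding sup_norm_def using assms(2) by (intro cSUP_upper) auto
qed

lemma B1_nonneg:
  assumes "\<theta> > 0" "l > 0"
  shows "0 \<le> B1 \<theta> l"
proof -
  have e: "exp (- \<theta>) < 1" using assms by simp
  then have e': "exp (- \<theta>) \<le> 1 + exp 1"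
    using exp_ge_zero[of "1::real"] by linarith
  from e e' have "0 \<le> (1 + exp 1 - exp (- \<theta>)) / (1 - exp (- \<theta>))"
    by (intro divide_nonneg_nonneg) auto
  with assms e e' show ?thesis
    unfolding B1_def by (intro add_nonneg_nonneg mult_nonneg_nonneg divide_nonneg_nonneg) auto
qed

text \<open>The two leading summands will absorb \<open>l * (2 + 2 * \<theta>)\<close>, the constant
  from the change of rate; the others are nonnegative.\<close>

lemma B2_ge:
  assumes "\<theta> > 0" "l > 0"
  shows "11 * l + 9 * l * \<theta> \<le> B2 \<theta> l"
proof -
  have e: "exp (- \<theta>) < 1" using assms by simp
  then have e': "exp (- \<theta>) \<le> 1 + exp 1"
    using exp_ge_zero[of "1::real"] by linarith
  from e e' have "0 \<le> (1 + exp 1 - exp (- \<theta>)) / ((1 - exp (- \<theta>)) * exp 1)"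
    by (intro divide_nonneg_nonneg) auto
  with assms e e' show ?thesis
    unfolding B2_def add.assoc le_add_same_cancel1 add_le_cancel_left
    by (intro add_nonneg_nonneg mult_nonneg_nonneg divide_nonneg_nonneg) auto
qed

lemma B3_nonneg:
  assumes "\<theta> > 0" "l > 0"
  shows "0 \<le> B3 \<theta> l"
proof -
  have e: "exp (- \<theta>) < 1" using assms by simp
  then have e': "exp (- \<theta>) \<le> 1 + exp 1"
    using exp_ge_zero[of "1::real"] by linarith
  from e e' have "0 \<le> (1 + exp 1 - exp (- \<theta>)) / ((1 - exp (- \<theta>)) * exp 1)"
    by (intro divide_nonneg_nonneg) auto
  with assms e e' show ?thesis
    unfolding B3_def by (intro add_nonneg_nonneg mult_nonneg_nonneg divide_nonneg_nonneg) auto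
qed

section \<open>Combining rounding and change of rate\<close>

theorem theorem4p11:
  fixes \<theta> l :: real and n :: nat
    and M :: "'a measure" and N :: "'b measure"
    and WG :: "'a \<Rightarrow> nat" and W :: "'b \<Rightarrow> real"
    and h h' :: "real \<Rightarrow> real"
  assumes "\<theta> > 0" and "n \<ge> 1" and "0 < l" and "l < real n"
    and "prob_space M" and "PG_distributed M WG \<theta> (l / real n)"
    and "prob_space N" and "PE_distributed N W \<theta> l"
    and "bounded (h ` {0<..})"
    and "\<And>x. x > 0 \<Longrightarrow> (h has_real_derivative h' x) (at x)"
    and "bounded (h' ` {0<..})"
  defines "Z \<equiv> (\<lambda>\<omega>. real (WG \<omega>) / real n)"
    and "h_tilde \<equiv> (\<lambda>x. h x - prob_space.expectation N (\<lambda>\<omega>. h (W \<omega>)))"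
  shows "\<bar>prob_space.expectation M (\<lambda>\<omega>. h (Z \<omega>)) - prob_space.expectation N (\<lambda>\<omega>. h (W \<omega>))\<bar>
    \<le> exp (l / n) / n * (1 + exp (\<theta> * l / (n * exp 1)) / n * B1 \<theta> l) * sup_norm h'
      + 1 / n *
        ((1 - l / n) powi (-6)
           * exp (\<theta> * exp (l / n) + \<theta> * l / n + 2 * (\<theta> * l / (n * exp 1)) + l / n) * B2 \<theta> l
         + 1 / (2 * n) * exp (l / n + \<theta> * l / (n * exp 1)) * B3 \<theta> l) * sup_norm h_tilde"
proof -
  define p where "p = l / real n"
  \<comment> \<open>The rate for which rounding yields success probability \<open>p\<close>, that is
    \<open>exp (- \<mu> / n) = 1 - p\<close>.\<close>
  define \<mu> where "\<mu> = - real n * ln (1 - p)"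
  have n: "real n > 0" using assms by simp
  have p: "0 < p" "p < 1" using assms n by (auto simp: p_def)
  have np: "real n * p = l" using n by (simp add: p_def)
  interpret M: prob_space M by fact
  interpret N: prob_space N by fact
  have "ln (1 - p) < ln (exp (- p))"
    using p by (subst ln_less_cancel_iff) (auto simp: exp_minus_greater)
  then have "ln (1 - p) < - p" by simp
  then have "real n * p < real n * - ln (1 - p)"
    using n by (intro mult_strict_left_mono) auto
  then have "real n * p < \<mu>" by (simp add: \<mu>_def)
  then have \<mu>: "l < \<mu>" by (simp add: np)
  \<comment> \<open>The inequality \<open>ln y \<le> y - 1\<close> at \<open>y = 1 / (1 - p)\<close>
    bounds \<open>\<mu>\<close> from above.\<close>
  have "ln (1 / (1 - p)) \<le> 1 / (1 - p) - 1"
    using p by (intro ln_le_minus_one) simp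
  then have "- ln (1 - p) \<le> p / (1 - p)"
    using p by (simp add: ln_div field_simps)
  then have "real n * - ln (1 - p) \<le> real n * (p / (1 - p))"
    by (rule mult_left_mono) simp
  then have \<mu>_le: "\<mu> \<le> l / (1 - p)" by (simp add: \<mu>_def np)
  have exp_\<mu>: "exp (- \<mu> / real n) = 1 - p"
    using n p by (simp add: \<mu>_def)
  have \<mu>0: "\<mu> > 0" using \<mu> assms by simp
  define S where "S = sup_norm h_tilde"
  define L where "L = sup_norm h'"
  define m where "m = N.expectation (\<lambda>\<omega>. h (W \<omega>))"
  obtain b where b: "\<And>x. x > 0 \<Longrightarrow> \<bar>h x\<bar> \<le> b"
    using \<open>bounded (h ` {0<..})\<close> by (force simp: bounded_iff)
  have tilde: "h_tilde = (\<lambda>x. h x - m)" by (simp add: h_tilde_def m_def)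
  have "bounded (h_tilde ` {0<..})"
    unfolding bounded_iff tilde
  proof (intro exI[of _ "b + \<bar>m\<bar>"] ballI)
    fix y assume "y \<in> (\<lambda>x. h x - m) ` {0<..}"
    then obtain x where "x > 0" "y = h x - m" by auto
    then show "norm y \<le> b + \<bar>m\<bar>" using b[of x] by simp
  qed
  then have S: "\<bar>h x - m\<bar> \<le> S" if "x > 0" for x
    using le_sup_norm[of h_tilde x] that by (simp add: S_def tilde)
  have L: "\<bar>h' x\<bar> \<le> L" if "x > 0" for x
    using le_sup_norm[of h' x] that assms by (simp add: L_def)
  have S0: "0 \<le> S" and L0: "0 \<le> L" using S[of 1] L[of 1] by auto
  \<comment> \<open>Nothing is known about \<open>h\<close> off the open half-line, so measurability
    is derived from continuity there.\<close>
  have "continuous_on {0<..} h"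
    using assms(10) by (intro continuous_at_imp_continuous_on) (auto intro: DERIV_isCont)
  then have h_meas: "h \<in> borel_measurable pos_lborel"
    using borel_measurable_continuous_on_restrict[of "{0<..}" h]
    by (simp cong: measurable_cong_sets sets_restrict_space_cong)
  let ?r = "\<lambda>w. real (nat \<lceil>real n * w\<rceil>) / real n"
  have ceil_meas: "(\<lambda>w. nat \<lceil>real n * w\<rceil>) \<in> measurable pos_lborel (count_space UNIV)"
    by (intro measurable_restrict_space1) measurable
  have hr_meas: "(\<lambda>w. h (?r w)) \<in> borel_measurable pos_lborel"
    using measurable_compose[OF ceil_meas, of "\<lambda>k. h (real k / real n)"] by simp
  have r_pos: "?r w > 0" if "w > 0" for w
    using that n by simp
  \<comment> \<open>\<open>Z\<close> has the law of \<open>?r\<close> applied to a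
    Poisson-exponential variable of rate \<open>\<mu>\<close>, so both expectations become integrals
    over one space.\<close>
  have EZ: "M.expectation (\<lambda>\<omega>. h (Z \<omega>)) = (\<integral>w. PE_density \<theta> \<mu> w * h (?r w) \<partial>pos_lborel)"
  proof -
    have WG: "WG \<in> measurable M (count_space UNIV)"
      "distr M (count_space UNIV) WG = measure_pmf (PG_pmf \<theta> p)"
      using assms(6) by (auto simp: PG_distributed_def p_def)
    have "M.expectation (\<lambda>\<omega>. h (Z \<omega>)) = (\<integral>k. h (real k / real n) \<partial>measure_pmf (PG_pmf \<theta> p))"
      unfolding Z_def WG(2)[symmetric] using WG(1) by (subst integral_distr) auto
    also have "\<dots> = (\<integral>w. h (?r w) \<partial>density pos_lborel (PE_density \<theta> \<mu>))"
      using assms p \<mu>0 exp_\<mu> ceil_meas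
      by (subst distr_ceiling_PE_eq_PG[symmetric, of \<theta> \<mu> p n]) (auto simp: integral_distr)
    also have "\<dots> = (\<integral>w. PE_density \<theta> \<mu> w * h (?r w) \<partial>pos_lborel)"
      using assms \<mu>0 hr_meas
      by (subst integral_density) (auto simp: PE_density_nonneg intro: borel_measurable_pos_lborel)
    finally show ?thesis .
  qed
  have EW: "m = (\<integral>w. PE_density \<theta> l w * h w \<partial>pos_lborel)"
    unfolding m_def using assms h_meas
    by (subst distributed_integral[symmetric, of N pos_lborel W "PE_density \<theta> l"])
       (auto simp: PE_distributed_def PE_density_nonneg)
  have int: "integrable pos_lborel (\<lambda>w. PE_density \<theta> \<mu> w * h (?r w))"
    "integrable pos_lborel (\<lambda>w. PE_density \<theta> s w * h w)" if "s > 0" for s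
    using assms \<mu>0 b r_pos h_meas hr_meas that by (auto intro!: integrable_PE_density_mult[where S = b])
  \<comment> \<open>Every density has mass 1, so subtracting \<open>m\<close> does not affect
    differences of expectations; this is how \<open>sup_norm h_tilde\<close> enters.\<close>
  have center: "(\<integral>w. PE_density \<theta> s w * (h w - m) \<partial>pos_lborel)
      = (\<integral>w. PE_density \<theta> s w * h w \<partial>pos_lborel) - m" if "s > 0" for s
    using int(2)[OF that] has_bochner_integral_PE_density[OF assms(1) that]
    by (simp add: right_diff_distrib has_bochner_integral_iff)
  have 1: "\<bar>(\<integral>w. PE_density \<theta> \<mu> w * h (?r w) \<partial>pos_lborel)
      - (\<integral>w. PE_density \<theta> \<mu> w * h w \<partial>pos_lborel)\<bar> \<le> L / n"
    using assms L \<mu>0 int by (intro PE_expectation_ceiling_diff_le) auto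
  have 2: "\<bar>(\<integral>w. PE_density \<theta> \<mu> w * (h w - m) \<partial>pos_lborel)
        - (\<integral>w. PE_density \<theta> l w * (h w - m) \<partial>pos_lborel)\<bar>
      \<le> (\<mu> - l) * (\<theta> / (1 - exp (- \<theta>))) * (1 / l + \<mu> / l\<^sup>2) * S"
    using assms \<mu> S h_meas by (intro PE_expectation_rate_diff_le) auto
  \<comment> \<open>Equivalent to \<open>(1 + \<theta>) * exp (- \<theta>) \<le> 1\<close>.\<close>
  have "\<theta> / (1 - exp (- \<theta>)) \<le> 1 + \<theta>"
  proof -
    have "(1 + \<theta>) * exp (- \<theta>) \<le> exp \<theta> * exp (- \<theta>)"
      by (intro mult_right_mono exp_ge_add_one_self) simp
    also have "\<dots> = 1" by (simp add: exp_minus)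
    finally show ?thesis using assms(1) by (simp add: field_simps)
  qed
  moreover have "\<mu> - l \<le> l * p / (1 - p)"
    using \<mu>_le p by (simp add: field_simps)
  moreover have "1 / l + \<mu> / l\<^sup>2 \<le> 2 / (l * (1 - p))"
  proof -
    have "\<mu> / l\<^sup>2 \<le> (l / (1 - p)) / l\<^sup>2"
      by (intro divide_right_mono \<mu>_le) simp
    also have "\<dots> = 1 / (l * (1 - p))"
      using assms by (simp add: power2_eq_square)
    moreover have "1 / l \<le> 1 / (l * (1 - p))"
      using assms p by (intro divide_left_mono) (auto simp: mult_le_cancel_left1)
    ultimately show ?thesis by simp
  qed
  \<comment> \<open>In the product of the three bounds \<open>l\<close> cancels, and the remaining
    \<open>p = l / n\<close> supplies the order \<open>1 / n\<close>.\<close>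
  ultimately have "(\<mu> - l) * (\<theta> / (1 - exp (- \<theta>))) * (1 / l + \<mu> / l\<^sup>2)
      \<le> (l * p / (1 - p)) * (1 + \<theta>) * (2 / (l * (1 - p)))"
    using assms p \<mu> \<mu>0 by (intro mult_mono) auto
  also have "\<dots> = p * (2 + 2 * \<theta>) / (1 - p)\<^sup>2"
  proof -
    have "(l * p / q) * (1 + \<theta>) * (2 / (l * q)) = p * (2 + 2 * \<theta>) / q\<^sup>2" if "q \<noteq> 0" for q
      using assms(3) that by (simp add: field_simps power2_eq_square)
    from this[of "1 - p"] p show ?thesis by simp
  qed
  also have "\<dots> = 1 / n * (inverse (1 - p) ^ 2 * (l * (2 + 2 * \<theta>)))"
    by (simp add: p_def divide_inverse power_inverse mult_ac)
  also have "\<dots> \<le> 1 / n * ((1 - l / n) powi (-6)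
           * exp (\<theta> * exp (l / n) + \<theta> * l / n + 2 * (\<theta> * l / (n * exp 1)) + l / n) * B2 \<theta> l
         + 1 / (2 * n) * exp (l / n + \<theta> * l / (n * exp 1)) * B3 \<theta> l)"
  proof (intro mult_left_mono)
    have B2: "l * (2 + 2 * \<theta>) \<le> B2 \<theta> l"
    proof -
      have "l * (2 + 2 * \<theta>) \<le> 11 * l + 9 * l * \<theta>"
        using assms(1,3) by (simp add: algebra_simps)
      also have "\<dots> \<le> B2 \<theta> l"
        using assms by (intro B2_ge)
      finally show ?thesis .
    qed
    have "B3 \<theta> l \<ge> 0" using assms by (intro B3_nonneg)
    then have B3: "0 \<le> 1 / (2 * n) * exp (l / n + \<theta> * l / (n * exp 1)) * B3 \<theta> l"
      by simp
    \<comment> \<open>As \<open>inverse (1 - p)\<close> is at least 1, the exponent may be raised to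
      the 6 of the stated bound.\<close>
    have "inverse (1 - p) ^ 2 \<le> inverse (1 - p) ^ 6"
      using p by (intro power_increasing) (auto simp: one_le_inverse_iff)
    also have "\<dots> = (1 - l / n) powi (-6)"
      by (simp add: power_int_def p_def)
    also have "\<dots> \<le> (1 - l / n) powi (-6)
        * exp (\<theta> * exp (l / n) + \<theta> * l / n + 2 * (\<theta> * l / (n * exp 1)) + l / n)"
      using assms p by (simp add: p_def power_int_def mult_le_cancel_left1)
    finally have "inverse (1 - p) ^ 2 * (l * (2 + 2 * \<theta>))
      \<le> (1 - l / n) powi (-6) * exp (\<theta> * exp (l / n) + \<theta> * l / n + 2 * (\<theta> * l / (n * exp 1)) + l / n)
          * B2 \<theta> l"
      using assms B2 p by (intro mult_mono) (auto simp: p_def)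
    with B3 show "inverse (1 - p) ^ 2 * (l * (2 + 2 * \<theta>))
      \<le> (1 - l / n) powi (-6)
           * exp (\<theta> * exp (l / n) + \<theta> * l / n + 2 * (\<theta> * l / (n * exp 1)) + l / n) * B2 \<theta> l
         + 1 / (2 * n) * exp (l / n + \<theta> * l / (n * exp 1)) * B3 \<theta> l"
      by linarith
  qed simp
  \<comment> \<open>Here \<open>\<dots>\<close> is the full coefficient of
    \<open>sup_norm h_tilde\<close> in the claim.\<close>
  finally have 3: "(\<mu> - l) * (\<theta> / (1 - exp (- \<theta>))) * (1 / l + \<mu> / l\<^sup>2) * S \<le> \<dots> * S"
    using S0 by (rule mult_right_mono)
  \<comment> \<open>Both \<open>exp (l / n)\<close> and the bracket are at least 1, the latter
    because \<open>B1\<close> is nonnegative.\<close>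
  have 4: "L / n \<le> exp (l / n) / n * (1 + exp (\<theta> * l / (n * exp 1)) / n * B1 \<theta> l) * L"
  proof -
    have "B1 \<theta> l \<ge> 0" using assms by (intro B1_nonneg)
    then have "1 * 1 \<le> exp (l / n) * (1 + exp (\<theta> * l / (n * exp 1)) / n * B1 \<theta> l)"
      using assms by (intro mult_mono) auto
    then have "1 * (L / n) \<le> exp (l / n) * (1 + exp (\<theta> * l / (n * exp 1)) / n * B1 \<theta> l) * (L / n)"
      using L0 by (intro mult_right_mono) auto
    then show ?thesis by simp
  qed
  \<comment> \<open>Triangle inequality through the expectation of \<open>h\<close> at rate
    \<open>\<mu>\<close>: rounding is paid by \<open>1\<close> and \<open>4\<close>, the change of
    rate by \<open>2\<close> and \<open>3\<close>.\<close>
  show ?thesis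
    using 1 2 3 4 center[of l] center[of \<mu>] \<mu>0 assms(3)
    unfolding EZ S_def[symmetric] L_def[symmetric] m_def[symmetric] EW[symmetric] by linarith
qed

end
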